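(* The worst-case performance ratio of the lower bound $\zeta(\mathrm{LP}_{\mathrm N})$ for the BPPS is zero: $$\varrho(\zeta(\mathrm{LP}_{\mathrm N}))=0.$$
   Context: Bin Packing Problem with Setups (BPPS). An instance consists of: a bin capacity $d\in\mathbb Z_{\ge1}$; items $\mathcal I=\{1,\dots,n\}$ with weights $w_i\in\mathbb Z_{\ge1}$; classes $\mathcal C=\{1,\dots,m\}$ and a partition $\{\mathcal I_1,\dots,\mathcal I_m\}$ of $\mathcal I$ into (nonempty) classes; for each class $c$ a setup weight $s_c\in\mathbb Z_{\ge0}$ and a setup cost $f_c\in\mathbb Z_{\ge0}$; a bin cost $r\in\mathbb Z_{\ge1}$. It is assumed that $w_i+s_c\le d$ for all $c\in\mathcal C$, $i\in\mathcal I_c$, and that the items cannot all be packed in a single bin, i.e. $\sum_{i\in\mathcal I}w_i+\sum_{c\in\mathcal C}s_c>d$. For $S\subseteq\mathcal I$ let $\mathcal C(S)=\{c\in\mathcal C: S\cap\mathcal I_c\neq\emptyset\}$. A packing pattern is a subset $S\subseteq\mathcal I$ with $\sum_{i\in S}w_i+\sum_{c\in\mathcal C(S)}s_c\le d$. A feasible solution is a partition $\mathcal S$ of $\mathcal I$ into (nonempty) packing patterns (used bins); its cost is $r|\mathcal S|+\sum_{S\in\mathcal S}\sum_{c\in\mathcal C(S)}f_c$. $OPT$ denotes the minimum cost of a feasible solution. For each instance let $k\in\mathbb Z_{\ge1}$ be an upper bound on the number of bins used in any optimal BPPS solution (for example $k=n$) and $\mathcal B=\{1,\dots,k\}$. The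 linear program $\mathrm{LP}_{\mathrm N}$ is: minimize $\sum_{b\in\mathcal B}\big(r z_b+\sum_{c\in\mathcal C}f_c y_{cb}\big)$ subject to - $\sum_{b\in\mathcal B}x_{ib}=1$ for all $i\in\mathcal I$; - $\sum_{i\in\mathcal I}w_ix_{ib}+\sum_{c\in\mathcal C}s_cy_{cb}\le d\,z_b$ for all $b\in\mathcal B$; - $x_{ib}\le y_{cb}$ for all $c\in\mathcal C$, $i\in\mathcal I_c$, $b\in\mathcal B$; - $0\le x_{ib}\le1$, $0\le y_{cb}\le1$, $0\le z_b\le1$ for all $i\in\mathcal I,c\in\mathcal C,b\in\mathcal B$. $\zeta(\mathrm{LP}_{\mathrm N})$ denotes its optimal objective function value; it is a lower bound on $OPT$. For a lower bound $LB$ on the optimum of a minimization problem, with $LB(I)$ its value and $OPT(I)>0$ the optimal value on instance $I$, the worst-case performance ratio $\varrho(LB)$ is the largest real number $\varrho\in[0,1]$ such that $LB(I)/OPT(I)\ge\varrho$ for all instances $I$. *)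

theory Defs
  imports Complex_Main "HOL-Library.Disjoint_Sets"
begin

section \<open>The Bin Packing Problem with Setups\<close>

text \<open>
  Items are \<open>{1..n_items I}\<close> and classes are \<open>{1..n_classes I}\<close>; the values of the
  function-valued fields outside these index sets are irrelevant.
\<close>

record bpps =
  capacity :: nat
  n_items :: nat
  weight :: "nat \<Rightarrow> nat"
  n_classes :: nat
  class_items :: "nat \<Rightarrow> nat set"
  setup_weight :: "nat \<Rightarrow> nat"
  setup_cost :: "nat \<Rightarrow> nat"
  bin_cost :: nat

definition items :: "bpps \<Rightarrow> nat set" where
  "items I = {1..n_items I}"

definition classes :: "bpps \<Rightarrow> nat set" where
  "classes I = {1..n_classes I}"

text \<open>
  Injectivity is needed because \<^const>\<open>partition_on\<close> speaks about the set of classes only: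
  distinct class indices must name distinct classes.
\<close>

definition bpps_instance :: "bpps \<Rightarrow> bool" where
  "bpps_instance I \<longleftrightarrow>
     capacity I \<ge> 1 \<and>
     bin_cost I \<ge> 1 \<and>
     (\<forall>i\<in>items I. weight I i \<ge> 1) \<and>
     partition_on (items I) (class_items I ` classes I) \<and>
     inj_on (class_items I) (classes I) \<and>
     (\<forall>c\<in>classes I. \<forall>i\<in>class_items I c. weight I i + setup_weight I c \<le> capacity I) \<and>
     (\<Sum>i\<in>items I. weight I i) + (\<Sum>c\<in>classes I. setup_weight I c) > capacity I"

definition classes_of :: "bpps \<Rightarrow> nat set \<Rightarrow> nat set" where
  "classes_of I S = {c \<in> classes I. S \<inter> class_items I c \<noteq> {}}"

definition packing_pattern :: "bpps \<Rightarrow> nat set \<Rightarrow> bool" where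
  "packing_pattern I S \<longleftrightarrow>
     S \<subseteq> items I \<and>
     (\<Sum>i\<in>S. weight I i) + (\<Sum>c\<in>classes_of I S. setup_weight I c) \<le> capacity I"

definition feasible_solution :: "bpps \<Rightarrow> nat set set \<Rightarrow> bool" where
  "feasible_solution I P \<longleftrightarrow> partition_on (items I) P \<and> (\<forall>S\<in>P. packing_pattern I S)"

definition solution_cost :: "bpps \<Rightarrow> nat set set \<Rightarrow> nat" where
  "solution_cost I P =
     bin_cost I * card P + (\<Sum>S\<in>P. \<Sum>c\<in>classes_of I S. setup_cost I c)"

definition OPT :: "bpps \<Rightarrow> nat" where
  "OPT I = Min (solution_cost I ` {P. feasible_solution I P})"

definition optimal_solution :: "bpps \<Rightarrow> nat set set \<Rightarrow> bool" where
  "optimal_solution I P \<longleftrightarrow> feasible_solution I P \<and> solution_cost I P = OPT I"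

definition bin_bound :: "bpps \<Rightarrow> nat \<Rightarrow> bool" where
  "bin_bound I k \<longleftrightarrow> k \<ge> 1 \<and> (\<forall>P. optimal_solution I P \<longrightarrow> card P \<le> k)"

section \<open>The linear program\<close>

definition LPN_feasible ::
  "bpps \<Rightarrow> nat \<Rightarrow> (nat \<Rightarrow> nat \<Rightarrow> real) \<Rightarrow> (nat \<Rightarrow> nat \<Rightarrow> real) \<Rightarrow> (nat \<Rightarrow> real) \<Rightarrow> bool" where
  "LPN_feasible I k x y z \<longleftrightarrow>
     (\<forall>i\<in>items I. (\<Sum>b\<in>{1..k}. x i b) = 1) \<and>
     (\<forall>b\<in>{1..k}. (\<Sum>i\<in>items I. real (weight I i) * x i b)
        + (\<Sum>c\<in>classes I. real (setup_weight I c) * y c b) \<le> real (capacity I) * z b) \<and>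
     (\<forall>c\<in>classes I. \<forall>i\<in>class_items I c. \<forall>b\<in>{1..k}. x i b \<le> y c b) \<and>
     (\<forall>i\<in>items I. \<forall>b\<in>{1..k}. 0 \<le> x i b \<and> x i b \<le> 1) \<and>
     (\<forall>c\<in>classes I. \<forall>b\<in>{1..k}. 0 \<le> y c b \<and> y c b \<le> 1) \<and>
     (\<forall>b\<in>{1..k}. 0 \<le> z b \<and> z b \<le> 1)"

definition LPN_objective ::
  "bpps \<Rightarrow> nat \<Rightarrow> (nat \<Rightarrow> nat \<Rightarrow> real) \<Rightarrow> (nat \<Rightarrow> real) \<Rightarrow> real" where
  "LPN_objective I k y z =
     (\<Sum>b\<in>{1..k}. real (bin_cost I) * z b + (\<Sum>c\<in>classes I. real (setup_cost I c) * y c b))"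

text \<open>
  If \<open>k\<close> bounds the number of bins of the optimal solutions, the feasible region is nonempty and
  compact in the relevant coordinates, so that the infimum is attained.
\<close>

definition zeta_LPN :: "bpps \<Rightarrow> nat \<Rightarrow> real" where
  "zeta_LPN I k = Inf {LPN_objective I k y z | x y z. LPN_feasible I k x y z}"

section \<open>Worst-case performance ratio\<close>

definition worst_case_ratio :: "'a set \<Rightarrow> ('a \<Rightarrow> real) \<Rightarrow> ('a \<Rightarrow> real) \<Rightarrow> real" where
  "worst_case_ratio Inst opt LB =
     (GREATEST \<rho>. 0 \<le> \<rho> \<and> \<rho> \<le> 1 \<and> (\<forall>I\<in>Inst. LB I / opt I \<ge> \<rho>))"

end

theory Submission
  imports Defs
begin

text \<open>
  Distributing every item and every setup evenly over the \<open>k\<close> bins shows that the optimum of the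
  linear program is at most \<open>r \<cdot> W / d + \<Sum> f\<^sub>c\<close>, where \<open>W\<close> is the total weight of all items and of one
  setup per class, whatever \<open>k\<close> is. On the instance with \<open>n\<close> items of weight 1 in a single class of
  setup weight \<open>n\<close>, with \<open>d = n + 1\<close>, \<open>r = 1\<close> and no setup costs, this is less than 2, while every
  bin holds at most one item, so that \<open>OPT = n\<close>.
\<close>

lemma finite_items [simp]: "finite (items I)"
  by (simp add: items_def)

lemma finite_classes [simp]: "finite (classes I)"
  by (simp add: classes_def)

lemma feasible_solution_subset_Pow: "feasible_solution I P \<Longrightarrow> P \<subseteq> Pow (items I)"
  by (auto simp: feasible_solution_def packing_pattern_def)

lemma finite_feasible_solutions: "finite {P. feasible_solution I P}"
  by (rule finite_subset[of _ "Pow (Pow (items I))"]) (auto dest: feasible_solution_subset_Pow)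

lemma feasible_solution_finite: "feasible_solution I P \<Longrightarrow> finite P"
  by (meson feasible_solution_subset_Pow finite_Pow_iff finite_items finite_subset)

text \<open>A one-item bin carries a single setup, so the assumption that each item fits together
  with the setup of its class is exactly its capacity constraint. This supplies the nonemptiness
  that makes \<open>Min\<close> in \<open>OPT\<close> meaningful.\<close>

lemma singletons_feasible_solution:
  assumes "bpps_instance I"
  shows "feasible_solution I ((\<lambda>i. {i}) ` items I)"
  unfolding feasible_solution_def
proof (intro conjI ballI)
  show "partition_on (items I) ((\<lambda>i. {i}) ` items I)"
    by (auto simp: partition_on_def disjoint_def)
next
  fix S assume "S \<in> (\<lambda>i. {i}) ` items I"
  then obtain i where i: "i \<in> items I" "S = {i}" by auto
  have part: "partition_on (items I) (class_items I ` classes I)"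
    and inj: "inj_on (class_items I) (classes I)"
    and fits: "\<And>c. c \<in> classes I \<Longrightarrow> i \<in> class_items I c \<Longrightarrow>
      weight I i + setup_weight I c \<le> capacity I"
    using assms by (auto simp: bpps_instance_def)
  obtain c where c: "c \<in> classes I" "i \<in> class_items I c"
    using partition_onD1[OF part] i(1) by blast
  \<comment> \<open>Disjointness only identifies the two item sets; injectivity then identifies the
    indices.\<close>
  have "c' = c" if "c' \<in> classes I" "i \<in> class_items I c'" for c'
  proof -
    have "class_items I c' = class_items I c"
      using partition_onD2[OF part] that c by (auto simp: disjoint_def)
    then show ?thesis
      using inj that c by (auto dest: inj_onD)
  qed
  then have "classes_of I S = {c}"
    using c unfolding classes_of_def i(2) by blast
  then show "packing_pattern I S"
    using fits[OF c] i by (simp add: packing_pattern_def)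
qed

lemma optimal_solution_exists:
  assumes "bpps_instance I"
  obtains P where "optimal_solution I P"
proof -
  have "OPT I \<in> solution_cost I ` {P. feasible_solution I P}"
    unfolding OPT_def using singletons_feasible_solution[OF assms] finite_feasible_solutions
    by (intro Min_in) auto
  then show thesis
    using that by (auto simp: optimal_solution_def)
qed

lemma sum_UN_le_nat:
  fixes f :: "'a \<Rightarrow> nat"
  assumes "finite A" "\<And>S. S \<in> A \<Longrightarrow> finite (B S)"
  shows "sum f (\<Union>S\<in>A. B S) \<le> (\<Sum>S\<in>A. sum f (B S))"
  using assms
proof (induction A rule: finite_induct)
  case (insert S A)
  have "sum f (B S \<union> (\<Union>S\<in>A. B S)) \<le> sum f (B S) + sum f (\<Union>S\<in>A. B S)"
    using insert by (subst sum_Un_nat) auto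
  also have "\<dots> \<le> sum f (B S) + (\<Sum>S\<in>A. sum f (B S))"
    using insert by simp
  finally show ?case
    using insert by simp
qed simp

definition total_weight :: "bpps \<Rightarrow> nat" where
  "total_weight I = (\<Sum>i\<in>items I. weight I i) + (\<Sum>c\<in>classes I. setup_weight I c)"

text \<open>Sum the capacity constraints over all bins: each item is counted once, and each class,
  being nonempty, is set up in at least one bin.\<close>

lemma total_weight_le_capacity_mult_card:
  assumes I: "bpps_instance I" and P: "feasible_solution I P"
  shows "total_weight I \<le> capacity I * card P"
proof -
  have part: "partition_on (items I) P"
    and patt: "\<And>S. S \<in> P \<Longrightarrow> packing_pattern I S"
    using P by (auto simp: feasible_solution_def)
  have finP: "finite P" using P by (rule feasible_solution_finite)
  have finS: "finite S" if "S \<in> P" for S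
    using patt[OF that] finite_subset[of S "items I"] by (auto simp: packing_pattern_def)
  have cover: "classes I \<subseteq> (\<Union>S\<in>P. classes_of I S)"
  proof
    fix c assume c: "c \<in> classes I"
    have cls: "partition_on (items I) (class_items I ` classes I)"
      using I by (simp add: bpps_instance_def)
    obtain i where i: "i \<in> class_items I c"
      using partition_onD3[OF cls] c by (metis ex_in_conv image_eqI)
    then have "i \<in> items I"
      using partition_onD1[OF cls] c by auto
    then obtain S where "S \<in> P" "i \<in> S"
      using partition_onD1[OF part] by auto
    then show "c \<in> (\<Union>S\<in>P. classes_of I S)"
      using c i by (auto simp: classes_of_def)
  qed
  have fin_cls: "finite (classes_of I S)" for S
    by (simp add: classes_of_def)
  have "(\<Sum>i\<in>items I. weight I i) = (\<Sum>S\<in>P. \<Sum>i\<in>S. weight I i)"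
    using partition_onD1[OF part] partition_onD2[OF part] finS
    by (auto simp: sum.Union_disjoint disjoint_def)
  \<comment> \<open>Setups satisfy only an inequality, since a class may be split over several bins
    and the sets \<open>classes_of I S\<close> may overlap.\<close>
  moreover have "(\<Sum>c\<in>classes I. setup_weight I c)
      \<le> (\<Sum>c\<in>(\<Union>S\<in>P. classes_of I S). setup_weight I c)"
    using cover finP fin_cls by (intro sum_mono2) auto
  moreover have "\<dots> \<le> (\<Sum>S\<in>P. \<Sum>c\<in>classes_of I S. setup_weight I c)"
    using finP fin_cls by (rule sum_UN_le_nat)
  ultimately have "total_weight I
      \<le> (\<Sum>S\<in>P. (\<Sum>i\<in>S. weight I i) + (\<Sum>c\<in>classes_of I S. setup_weight I c))"
    unfolding total_weight_def sum.distrib by linarith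
  also have "\<dots> \<le> (\<Sum>S\<in>P. capacity I)"
    using patt by (intro sum_mono) (auto simp: packing_pattern_def)
  finally show ?thesis by (simp add: mult.commute)
qed

text \<open>This is what keeps the uniform value of \<open>z\<close> at most 1. As
  \<open>bin_bound\<close> speaks of optimal solutions only, the count is applied to one of
  them.\<close>

lemma total_weight_le_capacity_mult_bin_bound:
  assumes "bpps_instance I" "bin_bound I k"
  shows "total_weight I \<le> capacity I * k"
proof -
  obtain P where P: "optimal_solution I P"
    using optimal_solution_exists[OF assms(1)] .
  have "total_weight I \<le> capacity I * card P"
    using assms(1) P by (intro total_weight_le_capacity_mult_card) (auto simp: optimal_solution_def)
  also have "\<dots> \<le> capacity I * k"
    using assms(2) P by (simp add: bin_bound_def)
  finally show ?thesis .
qed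

text \<open>The value of \<open>z\<close> makes every capacity constraint tight.\<close>

lemma LPN_feasible_uniform:
  assumes I: "bpps_instance I" and k: "bin_bound I k"
  shows "LPN_feasible I k (\<lambda>_ _. 1 / real k) (\<lambda>_ _. 1 / real k)
    (\<lambda>_. real (total_weight I) / (real (capacity I) * real k))"
proof -
  have pos: "capacity I \<ge> 1" "k \<ge> 1"
    using I k by (auto simp: bpps_instance_def bin_bound_def)
  have "real (total_weight I) \<le> real (capacity I) * real k"
    using total_weight_le_capacity_mult_bin_bound[OF I k] by (metis of_nat_le_iff of_nat_mult)
  moreover have "(\<Sum>i\<in>items I. real (weight I i) * (1 / real k))
      + (\<Sum>c\<in>classes I. real (setup_weight I c) * (1 / real k)) = real (total_weight I) / real k"
    unfolding total_weight_def sum_distrib_right[symmetric] by (simp add: add_divide_distrib)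
  ultimately show ?thesis
    using pos unfolding LPN_feasible_def by (auto simp: divide_le_eq)
qed

lemma LPN_objective_nonneg:
  assumes "LPN_feasible I k x y z"
  shows "LPN_objective I k y z \<ge> 0"
  using assms unfolding LPN_objective_def LPN_feasible_def
  by (intro sum_nonneg add_nonneg_nonneg mult_nonneg_nonneg) auto

text \<open>The uniform point also shows that the infimum is taken over a nonempty set.\<close>

lemma zeta_LPN_nonneg:
  assumes "bpps_instance I" "bin_bound I k"
  shows "zeta_LPN I k \<ge> 0"
  unfolding zeta_LPN_def
  using LPN_feasible_uniform[OF assms] LPN_objective_nonneg by (intro cInf_greatest) blast+

lemma zeta_LPN_le:
  assumes I: "bpps_instance I" and k: "bin_bound I k"
  shows "zeta_LPN I k \<le> real (bin_cost I) * real (total_weight I) / real (capacity I)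
    + (\<Sum>c\<in>classes I. real (setup_cost I c))"
proof -
  let ?y = "\<lambda>_ _. 1 / real k" and ?z = "\<lambda>_. real (total_weight I) / (real (capacity I) * real k)"
  have "zeta_LPN I k \<le> LPN_objective I k ?y ?z"
    unfolding zeta_LPN_def
  proof (rule cInf_lower)
    show "bdd_below {LPN_objective I k y z | x y z. LPN_feasible I k x y z}"
      by (rule bdd_belowI[of _ 0]) (auto dest: LPN_objective_nonneg)
  qed (use LPN_feasible_uniform[OF I k] in blast)
  \<comment> \<open>Summing over \<open>k\<close> equal bins cancels the factor
    \<open>1 / k\<close>, so the bound no longer depends on \<open>k\<close>.\<close>
  also have "\<dots> = real (bin_cost I) * real (total_weight I) / real (capacity I)
      + (\<Sum>c\<in>classes I. real (setup_cost I c))"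
    using k by (simp add: LPN_objective_def bin_bound_def distrib_left flip: sum_divide_distrib)
  finally show ?thesis .
qed

definition heavy_setup_instance :: "nat \<Rightarrow> bpps" where
  "heavy_setup_instance n = \<lparr>capacity = n + 1, n_items = n, weight = \<lambda>_. 1, n_classes = 1,
     class_items = \<lambda>_. {1..n}, setup_weight = \<lambda>_. n, setup_cost = \<lambda>_. 0, bin_cost = 1\<rparr>"

lemma heavy_setup_instance_simps [simp]:
  "capacity (heavy_setup_instance n) = n + 1"
  "items (heavy_setup_instance n) = {1..n}"
  "weight (heavy_setup_instance n) i = 1"
  "classes (heavy_setup_instance n) = {1}"
  "class_items (heavy_setup_instance n) c = {1..n}"
  "setup_weight (heavy_setup_instance n) c = n"
  "setup_cost (heavy_setup_instance n) c = 0"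
  "bin_cost (heavy_setup_instance n) = 1"
  by (simp_all add: heavy_setup_instance_def items_def classes_def)

text \<open>The total weight \<open>n + n\<close> exceeds the capacity \<open>n + 1\<close>
  precisely when \<open>n \<ge> 2\<close>.\<close>

lemma heavy_setup_instance:
  assumes "n \<ge> 2"
  shows "bpps_instance (heavy_setup_instance n)"
  using assms by (auto simp: bpps_instance_def partition_on_def)

lemma OPT_heavy_setup_instance_ge:
  assumes "n \<ge> 2"
  shows "n \<le> OPT (heavy_setup_instance n)"
proof -
  obtain P where "optimal_solution (heavy_setup_instance n) P"
    using optimal_solution_exists[OF heavy_setup_instance[OF assms]] .
  then have P: "feasible_solution (heavy_setup_instance n) P"
    and cost: "solution_cost (heavy_setup_instance n) P = OPT (heavy_setup_instance n)"
    by (auto simp: optimal_solution_def)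
  have part: "partition_on {1..n} P"
    using P by (simp add: feasible_solution_def)
  \<comment> \<open>A nonempty bin pays the setup \<open>n\<close>, which leaves one unit of
    capacity for items of weight 1.\<close>
  have card_le: "card S \<le> 1" if S: "S \<in> P" for S
  proof -
    have "S \<noteq> {}" "S \<subseteq> {1..n}"
      using partition_onD3[OF part] partition_onD1[OF part] S by auto
    then have "classes_of (heavy_setup_instance n) S = {1}"
      by (auto simp: classes_of_def)
    then show ?thesis
      using P S by (auto simp: feasible_solution_def packing_pattern_def)
  qed
  have "n = card (\<Union>P)"
    by (simp flip: partition_onD1[OF part])
  also have "\<dots> \<le> (\<Sum>S\<in>P. card S)"
    by (rule card_Union_le_sum_card)
  also have "\<dots> \<le> (\<Sum>S\<in>P. 1)"
    using card_le by (rule sum_mono)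
  \<comment> \<open>With unit bin cost and zero setup costs, the cost is the number of bins.\<close>
  also have "\<dots> = OPT (heavy_setup_instance n)"
    by (simp add: solution_cost_def flip: cost)
  finally show ?thesis .
qed

lemma heavy_setup_instance_ratio_le:
  assumes n: "n \<ge> 2" and k: "bin_bound (heavy_setup_instance n) k"
  shows "zeta_LPN (heavy_setup_instance n) k / real (OPT (heavy_setup_instance n)) \<le> 2 / real n"
proof (rule frac_le)
  have "zeta_LPN (heavy_setup_instance n) k \<le> real (n + n) / real (n + 1)"
    using zeta_LPN_le[OF heavy_setup_instance[OF n] k] by (simp add: total_weight_def)
  also have "\<dots> \<le> 2"
    by (simp add: divide_le_eq)
  finally show "zeta_LPN (heavy_setup_instance n) k \<le> 2" .
qed (use n OPT_heavy_setup_instance_ge[OF n] in auto)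

theorem proposition2:
  fixes k :: "bpps \<Rightarrow> nat"
  assumes "\<And>I. bpps_instance I \<Longrightarrow> bin_bound I (k I)"
  shows "worst_case_ratio {I. bpps_instance I} (\<lambda>I. real (OPT I)) (\<lambda>I. zeta_LPN I (k I)) = 0"
  unfolding worst_case_ratio_def
\<comment> \<open>Showing that 0 is admissible and bounds every admissible ratio also establishes
  that the greatest one exists.\<close>
proof (rule Greatest_equality)
  show "0 \<le> (0::real) \<and> (0::real) \<le> 1 \<and>
      (\<forall>I\<in>{I. bpps_instance I}. 0 \<le> zeta_LPN I (k I) / real (OPT I))"
    using zeta_LPN_nonneg assms by simp
next
  fix \<rho> :: real
  assume "0 \<le> \<rho> \<and> \<rho> \<le> 1 \<and> (\<forall>I\<in>{I. bpps_instance I}. \<rho> \<le> zeta_LPN I (k I) / real (OPT I))"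
  then have \<rho>: "\<rho> \<le> zeta_LPN I (k I) / real (OPT I)" if "bpps_instance I" for I
    using that by simp
  have "\<rho> \<le> 2 / real n" if "n \<ge> 2" for n
    using \<rho>[OF heavy_setup_instance[OF that]]
      heavy_setup_instance_ratio_le[OF that assms[OF heavy_setup_instance[OF that]]]
    by (rule order_trans)
  \<comment> \<open>Let \<open>n\<close> tend to infinity; the first 2 is the numerator, the second
    the threshold from which the bound holds.\<close>
  then show "\<rho> \<le> 0"
    by (intro LIMSEQ_le_const[OF lim_const_over_n[of 2]] exI[of _ 2]) auto
qed

end
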